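(* Let $n\ge 2$, let $X_i$ be a nonempty set and $d_i:X_i\times X_i\to\mathbb{R}$ a function $(i=1,\ldots,n)$, let $M:=X_1\times\cdots\times X_n$, and let $\psi\in\mathbf{\Psi}_n$. Define $$d_\psi(x,y):=\begin{cases}\left(\sum_{i=1}^n d_i(x_i,y_i)\right)\cdot\psi\left(\dfrac{d_1(x_1,y_1)}{\sum_{i=1}^n d_i(x_i,y_i)},\ldots,\dfrac{d_n(x_n,y_n)}{\sum_{i=1}^n d_i(x_i,y_i)}\right) & \text{if } x\neq y,\\ 0 & \text{if } x=y\end{cases}$$ for all $x:=(x_1,\ldots,x_n),\ y:=(y_1,\ldots,y_n)\in M$. Then $d_i$ is a metric on $X_i$ for every $i=1,\ldots,n$ if and only if $d_\psi$ is a metric on $M$.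
   Context: Let $\mathbb{R}_+$ denote the set of nonnegative real numbers and, for $n\ge 2$, let $\Omega_n:=\{(t_1,\ldots,t_n)\in\mathbb{R}^n_+ \mid \sum_{i=1}^n t_i=1\}$. The class $\mathbf{\Psi}_n$ consists of all continuous convex functions $\psi:\Omega_n\to\mathbb{R}$ such that $\psi(\mathbf{e}_1)=\cdots=\psi(\mathbf{e}_n)=1$, where $\mathbf{e}_1,\ldots,\mathbf{e}_n$ are the standard basis vectors of $\mathbb{R}^n$, and $$\psi(t_1,\ldots,t_n)\ge (1-t_i)\cdot\psi\left(\frac{t_1}{1-t_i},\ldots,\frac{t_{i-1}}{1-t_i},0,\frac{t_{i+1}}{1-t_i},\ldots,\frac{t_n}{1-t_i}\right)$$ for every $i=1,\ldots,n$ and all $(t_1,\ldots,t_n)\in\Omega_n$ with $t_i<1$.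
   Formalization: The formal theorem adds the hypothesis d_i(a,a)=0 for all i and all a in X_i; without it the converse fails, e.g. n=2, ψ=1, X_1={0}, d_1(0,0)=1, X_2={0,1} with d_2 the discrete metric: d_ψ is a metric but d_1 is not. *)

theory Defs
  imports "HOL-Analysis.Analysis"
begin

definition Omega :: "(real ^ 'n) set" where
  "Omega = {t. (\<forall>i. 0 \<le> t $ i) \<and> (\<Sum>i\<in>UNIV. t $ i) = 1}"

text \<open>A function on \<^const>\<open>Omega\<close> is represented by a total function on \<open>real ^ 'n\<close>; its values
  outside \<^const>\<open>Omega\<close> are unconstrained.\<close>

definition Psi :: "(real ^ 'n \<Rightarrow> real) set" where
  "Psi = {\<psi>. continuous_on Omega \<psi> \<and> convex_on Omega \<psi> \<and>
     (\<forall>i. \<psi> (axis i 1) = 1) \<and>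
     (\<forall>i. \<forall>t\<in>Omega. t $ i < 1 \<longrightarrow>
        \<psi> t \<ge> (1 - t $ i) * \<psi> (\<chi> j. if j = i then 0 else t $ j / (1 - t $ i)))}"

text \<open>The locale \<^locale>\<open>Metric_space\<close> demands nonnegativity and symmetry on the whole type, so a
  function that is only meaningful on \<open>X \<times> X\<close> is first set to \<open>0\<close> elsewhere.\<close>

definition metric_on :: "'a set \<Rightarrow> ('a \<Rightarrow> 'a \<Rightarrow> real) \<Rightarrow> bool" where
  "metric_on X d \<longleftrightarrow> Metric_space X (\<lambda>x y. if x \<in> X \<and> y \<in> X then d x y else 0)"

lemma metric_on_iff:
  "metric_on X d \<longleftrightarrow>
     (\<forall>x\<in>X. \<forall>y\<in>X. 0 \<le> d x y) \<and>
     (\<forall>x\<in>X. \<forall>y\<in>X. d x y = 0 \<longleftrightarrow> x = y) \<and>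
     (\<forall>x\<in>X. \<forall>y\<in>X. d x y = d y x) \<and>
     (\<forall>x\<in>X. \<forall>y\<in>X. \<forall>z\<in>X. d x z \<le> d x y + d y z)"
proof
  assume "metric_on X d"
  then interpret Metric_space X "\<lambda>x y. if x \<in> X \<and> y \<in> X then d x y else 0"
    by (simp add: metric_on_def)
  have a: "0 \<le> d x y" "d x y = 0 \<longleftrightarrow> x = y" "d x y = d y x" if "x \<in> X" "y \<in> X" for x y
    using nonneg[of x y] zero[of x y] commute[of x y] that by auto
  have b: "d x z \<le> d x y + d y z" if "x \<in> X" "y \<in> X" "z \<in> X" for x y z
    using triangle[of x y z] that by simp
  show "(\<forall>x\<in>X. \<forall>y\<in>X. 0 \<le> d x y) \<and> (\<forall>x\<in>X. \<forall>y\<in>X. d x y = 0 \<longleftrightarrow> x = y) \<and>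
     (\<forall>x\<in>X. \<forall>y\<in>X. d x y = d y x) \<and>
     (\<forall>x\<in>X. \<forall>y\<in>X. \<forall>z\<in>X. d x z \<le> d x y + d y z)"
    using a b by blast
qed (auto simp: metric_on_def Metric_space_def)

text \<open>For \<open>x \<noteq> y\<close> the argument of \<open>\<psi>\<close> lies in \<^const>\<open>Omega\<close> as soon as every \<open>d i\<close> is a metric
  on \<open>X i\<close>; for arbitrary functions \<open>d i\<close> it need not. Diagonal values \<open>d i a a\<close> enter only through pairs \<open>x \<noteq> y\<close>
  that agree in coordinate \<open>i\<close>, so metricity of \<open>dpsi \<psi> d\<close> alone does not force them to vanish.\<close>

definition dpsi ::
  "(real ^ 'n \<Rightarrow> real) \<Rightarrow> ('n \<Rightarrow> 'a \<Rightarrow> 'a \<Rightarrow> real) \<Rightarrow> ('n \<Rightarrow> 'a) \<Rightarrow> ('n \<Rightarrow> 'a) \<Rightarrow> real" where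
  "dpsi \<psi> d x y =
     (if x \<noteq> y
      then (\<Sum>i\<in>UNIV. d i (x i) (y i)) *
           \<psi> (\<chi> j. d j (x j) (y j) / (\<Sum>i\<in>UNIV. d i (x i) (y i)))
      else 0)"

end

theory Submission
  imports Defs
begin

text \<open>Extend \<open>\<psi>\<close> from the simplex to the nonnegative orthant as a positively homogeneous function
  \<open>N\<close>; then \<open>d\<^sub>\<psi>(x, y) = N(d\<^sub>1(x\<^sub>1, y\<^sub>1), \<dots>, d\<^sub>n(x\<^sub>n, y\<^sub>n))\<close> whenever the \<open>d\<^sub>i\<close> vanish on the diagonal.
  The proof uses three properties of \<open>N\<close>, inherited from \<open>\<psi> \<in> \<Psi>\<close>: convexity of \<open>\<psi>\<close> is
  subadditivity of \<open>N\<close>; the normalisation at the vertices says that \<open>N\<close> is the identity on each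
  coordinate axis; and the last inequality says that replacing a coordinate by \<open>0\<close> does not
  increase \<open>N\<close>. The last property and convexity make \<open>N\<close> monotone in every coordinate.

  If all \<open>d\<^sub>i\<close> are metrics, the triangle inequality for \<open>d\<^sub>\<psi>\<close> follows from those of the \<open>d\<^sub>i\<close>, as \<open>N\<close>
  is monotone and subadditive; and \<open>d\<^sub>\<psi>\<close> separates points since monotonicity gives \<open>N(v) \<ge> v\<^sub>i\<close>
  for each \<open>i\<close>. Conversely, \<open>d\<^sub>\<psi>\<close> restricted to points that agree outside the coordinate \<open>i\<close> is
  exactly \<open>d\<^sub>i\<close>, because \<open>N\<close> is the identity on the \<open>i\<close>-th axis; so \<open>X\<^sub>i\<close> embeds isometrically
  into the product and \<open>d\<^sub>i\<close> inherits the metric axioms.\<close>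

section \<open>The homogeneous extension of a function on the simplex\<close>

text \<open>At \<open>v = 0\<close> the argument of \<open>\<psi>\<close> is outside the simplex, but the factor in front makes the value
  \<open>0\<close>, which is the value the homogeneous extension must take there.\<close>

definition homogeneous_extension :: "(real ^ 'n \<Rightarrow> real) \<Rightarrow> real ^ 'n \<Rightarrow> real" where
  "homogeneous_extension \<psi> v =
     (\<Sum>i\<in>UNIV. v $ i) * \<psi> (\<chi> j. v $ j / (\<Sum>i\<in>UNIV. v $ i))"

lemma nonneg_vec_eq_0_or_sum_pos:
  fixes v :: "real ^ 'n::finite"
  assumes "\<And>i. 0 \<le> v $ i"
  shows "v = 0 \<or> 0 < (\<Sum>i\<in>UNIV. v $ i)"
proof (cases "(\<Sum>i\<in>UNIV. v $ i) = 0")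
  case True
  then have "\<forall>i\<in>UNIV. v $ i = 0"
    using assms by (subst (asm) sum_nonneg_eq_0_iff) auto
  then show ?thesis by (simp add: vec_eq_iff)
next
  case False
  moreover have "0 \<le> (\<Sum>i\<in>UNIV. v $ i)"
    using assms by (simp add: sum_nonneg)
  ultimately show ?thesis by simp
qed

lemma normalized_in_Omega:
  fixes v :: "real ^ 'n::finite"
  assumes "\<And>i. 0 \<le> v $ i" "0 < (\<Sum>i\<in>UNIV. v $ i)"
  shows "(\<chi> j. v $ j / (\<Sum>i\<in>UNIV. v $ i)) \<in> Omega"
  using assms by (simp add: Omega_def flip: sum_divide_distrib)

lemma homogeneous_extension_0 [simp]: "homogeneous_extension \<psi> 0 = 0"
  by (simp add: homogeneous_extension_def)

lemma homogeneous_extension_axis: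
  fixes \<psi> :: "real ^ 'n::finite \<Rightarrow> real"
  assumes "\<psi> (axis i 1) = 1"
  shows "homogeneous_extension \<psi> (axis i c) = c"
proof (cases "c = 0")
  case True
  then show ?thesis by (simp add: axis_eq_0_iff[THEN iffD2])
next
  case False
  have s: "(\<Sum>j\<in>UNIV. axis i c $ j) = c"
    by (simp add: axis_def)
  have "(\<chi> j. axis i c $ j / c) = axis i 1"
    using False by (simp add: axis_def vec_eq_iff)
  with assms show ?thesis
    by (simp add: homogeneous_extension_def s)
qed

lemma homogeneous_extension_scale:
  fixes v :: "real ^ 'n::finite"
  shows "homogeneous_extension \<psi> (c *\<^sub>R v) = c * homogeneous_extension \<psi> v"
  by (cases "c = 0") (simp_all add: homogeneous_extension_def flip: sum_distrib_left)

text \<open>The normalisation of \<open>u + v\<close> is the convex combination of the normalisations of \<open>u\<close> and \<open>v\<close>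
  with weights proportional to the coordinate sums of \<open>u\<close> and \<open>v\<close>.\<close>

lemma homogeneous_extension_subadditive:
  fixes u v :: "real ^ 'n::finite"
  assumes conv: "convex_on Omega \<psi>"
    and u: "\<And>i. 0 \<le> u $ i" and v: "\<And>i. 0 \<le> v $ i"
  shows "homogeneous_extension \<psi> (u + v)
           \<le> homogeneous_extension \<psi> u + homogeneous_extension \<psi> v"
proof (cases "u = 0 \<or> v = 0")
  case True
  then show ?thesis by auto
next
  case False
  define r where "r = (\<Sum>i\<in>UNIV. u $ i)"
  define s where "s = (\<Sum>i\<in>UNIV. v $ i)"
  define p where "p = (\<chi> j. u $ j / r)"
  define q where "q = (\<chi> j. v $ j / s)"
  have pos: "0 < r" "0 < s"
    using False nonneg_vec_eq_0_or_sum_pos[OF u] nonneg_vec_eq_0_or_sum_pos[OF v]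
    by (auto simp: r_def s_def)
  have mem: "p \<in> Omega" "q \<in> Omega"
    using normalized_in_Omega[OF u] normalized_in_Omega[OF v] pos
    by (auto simp: p_def q_def r_def s_def)
  have sum: "(\<Sum>i\<in>UNIV. (u + v) $ i) = r + s"
    by (simp add: r_def s_def sum.distrib)
  have comb: "(\<chi> j. (u + v) $ j / (r + s)) = (r / (r + s)) *\<^sub>R p + (s / (r + s)) *\<^sub>R q"
    using pos by (simp add: vec_eq_iff p_def q_def add_divide_distrib)
  have "0 \<le> r / (r + s)" "0 \<le> s / (r + s)" "r / (r + s) + s / (r + s) = 1"
    using pos by (simp_all flip: add_divide_distrib)
  with conv mem have "\<psi> ((r / (r + s)) *\<^sub>R p + (s / (r + s)) *\<^sub>R q)
          \<le> r / (r + s) * \<psi> p + s / (r + s) * \<psi> q"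
    unfolding convex_on_def by blast
  then have "(r + s) * \<psi> ((r / (r + s)) *\<^sub>R p + (s / (r + s)) *\<^sub>R q)
          \<le> (r + s) * (r / (r + s) * \<psi> p + s / (r + s) * \<psi> q)"
    using pos by (intro mult_left_mono) auto
  also have "\<dots> = r * \<psi> p + s * \<psi> q"
    using pos by (simp add: distrib_left)
  finally show ?thesis
    unfolding homogeneous_extension_def sum comb by (simp add: r_def s_def p_def q_def)
qed

section \<open>Monotonicity of the extension\<close>

text \<open>This is the last condition on \<open>\<Psi>\<close> at \<open>t = v / \<Sum>\<^sub>j v\<^sub>j\<close>, multiplied by \<open>\<Sum>\<^sub>j v\<^sub>j\<close>: the division
  by \<open>1 - t\<^sub>i\<close> there normalises the vector whose coordinate \<open>i\<close> has been set to \<open>0\<close>.\<close>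

lemma homogeneous_extension_zero_coordinate:
  fixes v :: "real ^ 'n::finite"
  assumes psi: "\<psi> \<in> Psi" and v: "\<And>j. 0 \<le> v $ j"
  shows "homogeneous_extension \<psi> (\<chi> j. if j = i then 0 else v $ j)
           \<le> homogeneous_extension \<psi> v"
proof -
  define w where "w = (\<chi> j. if j = i then 0 else v $ j)"
  define s where "s = (\<Sum>j\<in>UNIV. v $ j)"
  define t where "t = (\<chi> j. v $ j / s)"
  have sw: "(\<Sum>j\<in>UNIV. w $ j) = s - v $ i"
    by (simp add: w_def s_def sum.If_cases sum_diff1 Compl_eq_Diff_UNIV)
  have w: "0 \<le> w $ j" for j
    using v by (simp add: w_def)
  show ?thesis
  proof (cases "w = 0")
    \<comment> \<open>Here \<open>v\<close> is on the \<open>i\<close>-th axis: the inequality says nothing, but the value is known.\<close>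
    case True
    then have axis: "axis i (v $ i) = v"
      by (auto simp: w_def axis_def vec_eq_iff split: if_splits)
    have "\<psi> (axis i 1) = 1"
      using psi by (simp add: Psi_def)
    from homogeneous_extension_axis[of \<psi> i "v $ i", OF this]
    have "homogeneous_extension \<psi> v = v $ i"
      unfolding axis .
    with v True show ?thesis
      by (simp flip: w_def)
  next
    case False
    then have rest: "0 < s - v $ i"
      using nonneg_vec_eq_0_or_sum_pos[OF w] sw by simp
    then have s: "0 < s"
      using v[of i] by linarith
    have "t \<in> Omega"
      using normalized_in_Omega[OF v] s by (simp add: t_def s_def)
    moreover have ti: "1 - t $ i = (s - v $ i) / s"
      using s by (simp add: t_def diff_divide_distrib)
    then have "t $ i < 1"
      using rest s by (smt (verit) divide_pos_pos)
    ultimately have "(1 - t $ i) * \<psi> (\<chi> j. if j = i then 0 else t $ j / (1 - t $ i)) \<le> \<psi> t"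
      using psi unfolding Psi_def by blast
    moreover have "(\<chi> j. if j = i then 0 else t $ j / (1 - t $ i)) = (\<chi> j. w $ j / (s - v $ i))"
      unfolding ti using s by (simp add: vec_eq_iff t_def w_def)
    ultimately have "s * ((s - v $ i) / s * \<psi> (\<chi> j. w $ j / (s - v $ i))) \<le> s * \<psi> t"
      using s ti by (intro mult_left_mono) auto
    then have "homogeneous_extension \<psi> w \<le> homogeneous_extension \<psi> v"
      using s by (simp add: homogeneous_extension_def sw t_def flip: s_def)
    then show ?thesis by (simp only: w_def)
  qed
qed

text \<open>Lowering coordinate \<open>i\<close> lands on the segment between \<open>v\<close> and \<open>v\<close> with coordinate \<open>i\<close> set to
  \<open>0\<close>. The value at both ends is at most the value at \<open>v\<close>, and the extension is convex along the
  segment, being homogeneous and subadditive.\<close>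

lemma homogeneous_extension_mono_coordinate:
  fixes v :: "real ^ 'n::finite"
  assumes psi: "\<psi> \<in> Psi" and v: "\<And>j. 0 \<le> v $ j" and c: "0 \<le> c" "c \<le> v $ i"
  shows "homogeneous_extension \<psi> (\<chi> j. if j = i then c else v $ j)
           \<le> homogeneous_extension \<psi> v"
proof -
  define l where "l = c / v $ i"
  define w where "w = (\<chi> j. if j = i then 0 else v $ j)"
  \<comment> \<open>If \<open>v $ i = 0\<close> then \<open>l = 0\<close>, and the decomposition below still holds because \<open>c = 0\<close>.\<close>
  have l: "0 \<le> l" "l \<le> 1" "l * v $ i = c"
    using c v[of i] by (auto simp: l_def divide_le_eq_1)
  have split: "(\<chi> j. if j = i then c else v $ j) = l *\<^sub>R v + (1 - l) *\<^sub>R w"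
    using l(3) by (simp add: vec_eq_iff w_def algebra_simps)
  have conv: "convex_on Omega \<psi>"
    using psi by (simp add: Psi_def)
  have "homogeneous_extension \<psi> (l *\<^sub>R v + (1 - l) *\<^sub>R w)
          \<le> homogeneous_extension \<psi> (l *\<^sub>R v) + homogeneous_extension \<psi> ((1 - l) *\<^sub>R w)"
    using v l by (intro homogeneous_extension_subadditive[OF conv]) (simp_all add: w_def)
  also have "\<dots> = l * homogeneous_extension \<psi> v + (1 - l) * homogeneous_extension \<psi> w"
    by (simp add: homogeneous_extension_scale)
  also have "\<dots> \<le> l * homogeneous_extension \<psi> v + (1 - l) * homogeneous_extension \<psi> v"
    using homogeneous_extension_zero_coordinate[OF psi v] l
    by (intro add_left_mono mult_left_mono) (simp_all add: w_def)
  finally show ?thesis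
    by (simp add: split algebra_simps)
qed

lemma homogeneous_extension_mono:
  fixes u v :: "real ^ 'n::finite"
  assumes psi: "\<psi> \<in> Psi" and u: "\<And>j. 0 \<le> u $ j" and uv: "\<And>j. u $ j \<le> v $ j"
  shows "homogeneous_extension \<psi> u \<le> homogeneous_extension \<psi> v"
proof -
  \<comment> \<open>Pass from \<open>u\<close> to \<open>v\<close> by raising one coordinate at a time.\<close>
  define w where "w S = (\<chi> j. if j \<in> S then v $ j else u $ j)" for S
  have step: "homogeneous_extension \<psi> u \<le> homogeneous_extension \<psi> (w S)" if "finite S" for S
    using that
  proof (induction S)
    case empty
    then show ?case by (simp add: w_def)
  next
    case (insert i S)
    have nonneg: "0 \<le> w (insert i S) $ j" for j
      using order_trans[OF u[of j] uv[of j]] u[of j] by (simp add: w_def)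
    have "u $ i \<le> w (insert i S) $ i"
      using uv by (simp add: w_def)
    note homogeneous_extension_mono_coordinate[OF psi nonneg u this]
    moreover have "(\<chi> j. if j = i then u $ i else w (insert i S) $ j) = w S"
      using insert.hyps(2) by (auto simp: w_def vec_eq_iff)
    ultimately have "homogeneous_extension \<psi> (w S) \<le> homogeneous_extension \<psi> (w (insert i S))"
      by (simp only:)
    with insert.IH show ?case by linarith
  qed
  have "w UNIV = v"
    by (simp add: w_def vec_eq_iff)
  with step[of UNIV] show ?thesis by simp
qed

text \<open>The right-hand side is the value of the extension at the projection of \<open>v\<close> to the \<open>i\<close>-th
  axis, which lies below \<open>v\<close> coordinatewise.\<close>

lemma homogeneous_extension_ge_coordinate:
  fixes v :: "real ^ 'n::finite"
  assumes psi: "\<psi> \<in> Psi" and v: "\<And>j. 0 \<le> v $ j"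
  shows "v $ i \<le> homogeneous_extension \<psi> v"
proof -
  have "homogeneous_extension \<psi> (axis i (v $ i)) \<le> homogeneous_extension \<psi> v"
    using v by (intro homogeneous_extension_mono[OF psi]) (simp_all add: axis_def)
  moreover have "\<psi> (axis i 1) = 1"
    using psi by (simp add: Psi_def)
  ultimately show ?thesis
    by (simp add: homogeneous_extension_axis)
qed

section \<open>Metrics on the product\<close>

lemma dpsi_eq_homogeneous_extension:
  fixes d :: "'n::finite \<Rightarrow> 'a \<Rightarrow> 'a \<Rightarrow> real"
  assumes "\<And>i. d i (x i) (x i) = 0"
  shows "dpsi \<psi> d x y = homogeneous_extension \<psi> (\<chi> i. d i (x i) (y i))"
proof (cases "x = y")
  case True
  then have "(\<chi> i. d i (x i) (y i)) = 0"
    using assms by (simp add: vec_eq_iff)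
  with True show ?thesis by (simp add: dpsi_def)
qed (simp add: dpsi_def homogeneous_extension_def)

text \<open>Fixing all coordinates but the \<open>i\<close>-th embeds \<open>X\<^sub>i\<close> isometrically, as the vector of coordinate
  distances then lies on the \<open>i\<close>-th axis.\<close>

lemma dpsi_fun_upd:
  fixes d :: "'n::finite \<Rightarrow> 'a \<Rightarrow> 'a \<Rightarrow> real"
  assumes "\<psi> (axis i 1) = 1" "\<And>j. d j (z j) (z j) = 0" "d i a a = 0"
  shows "dpsi \<psi> d (z(i := a)) (z(i := b)) = d i a b"
proof -
  have "(\<chi> j. d j ((z(i := a)) j) ((z(i := b)) j)) = axis i (d i a b)"
    using assms(2) by (simp add: axis_def vec_eq_iff)
  moreover have "d j ((z(i := a)) j) ((z(i := a)) j) = 0" for j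
    using assms(2,3) by simp
  ultimately show ?thesis
    using dpsi_eq_homogeneous_extension[of d "z(i := a)" \<psi> "z(i := b)"]
      homogeneous_extension_axis[of \<psi> i "d i a b"] assms(1)
    by simp
qed

lemma metric_on_isometric_pullback:
  assumes Y: "metric_on Y D" and f: "f ` X \<subseteq> Y" "inj_on f X"
    and isometry: "\<And>a b. a \<in> X \<Longrightarrow> b \<in> X \<Longrightarrow> D (f a) (f b) = d a b"
  shows "metric_on X d"
proof -
  have D: "\<forall>x\<in>Y. \<forall>y\<in>Y. 0 \<le> D x y" "\<forall>x\<in>Y. \<forall>y\<in>Y. D x y = 0 \<longleftrightarrow> x = y"
    "\<forall>x\<in>Y. \<forall>y\<in>Y. D x y = D y x" "\<forall>x\<in>Y. \<forall>y\<in>Y. \<forall>z\<in>Y. D x z \<le> D x y + D y z"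
    using Y unfolding metric_on_iff by - (elim conjE, assumption)+
  have in_Y: "f a \<in> Y" if "a \<in> X" for a
    using f(1) that by (rule image_subset_iff[THEN iffD1, THEN bspec])
  show ?thesis
    unfolding metric_on_iff
  proof (intro conjI ballI)
    show "0 \<le> d a b" if "a \<in> X" "b \<in> X" for a b
      unfolding isometry[OF that, symmetric] using D(1) that[THEN in_Y] by blast
    show "d a b = 0 \<longleftrightarrow> a = b" if "a \<in> X" "b \<in> X" for a b
      unfolding isometry[OF that, symmetric] inj_on_eq_iff[OF f(2) that, symmetric]
      using D(2) that[THEN in_Y] by blast
    show "d a b = d b a" if "a \<in> X" "b \<in> X" for a b
      unfolding isometry[OF that, symmetric] isometry[OF that(2,1), symmetric]
      using D(3) that[THEN in_Y] by blast
    show "d a c \<le> d a b + d b c" if "a \<in> X" "b \<in> X" "c \<in> X" for a b c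
      unfolding isometry[OF that(1,2), symmetric] isometry[OF that(2,3), symmetric]
        isometry[OF that(1,3), symmetric]
      using D(4) that[THEN in_Y] by blast
  qed
qed

lemma metric_on_dpsi:
  fixes d :: "'n::finite \<Rightarrow> 'a \<Rightarrow> 'a \<Rightarrow> real"
  assumes psi: "\<psi> \<in> Psi" and metric: "\<And>i. metric_on (X i) (d i)"
  shows "metric_on (\<Pi>\<^sub>E i\<in>UNIV. X i) (dpsi \<psi> d)"
proof -
  let ?M = "\<Pi>\<^sub>E i\<in>UNIV. X i"
  define dist_vec where "dist_vec x y = (\<chi> i. d i (x i) (y i))" for x y
  have in_X: "x i \<in> X i" if "x \<in> ?M" for x i
    using that by auto
  have nonneg: "0 \<le> d i a b" and zero: "d i a b = 0 \<longleftrightarrow> a = b" and sym: "d i a b = d i b a"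
    if "a \<in> X i" "b \<in> X i" for i a b
    using metric[of i] that by (simp_all add: metric_on_iff)
  have triangle: "d i a c \<le> d i a b + d i b c" if "a \<in> X i" "b \<in> X i" "c \<in> X i" for i a b c
    using metric[of i] that by (simp add: metric_on_iff)
  have dpsi: "dpsi \<psi> d x y = homogeneous_extension \<psi> (dist_vec x y)" if "x \<in> ?M" for x y
    using zero[OF in_X in_X, OF that that] unfolding dist_vec_def
    by (intro dpsi_eq_homogeneous_extension) simp
  have vec_nonneg: "0 \<le> dist_vec x y $ i" if "x \<in> ?M" "y \<in> ?M" for x y i
    using nonneg[OF in_X in_X, OF that] by (simp add: dist_vec_def)
  have ge: "d i (x i) (y i) \<le> dpsi \<psi> d x y" if "x \<in> ?M" "y \<in> ?M" for x y i
    using homogeneous_extension_ge_coordinate[OF psi vec_nonneg[OF that], of i] dpsi[OF that(1), of y]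
    by (simp add: dist_vec_def)
  have M_nonneg: "0 \<le> dpsi \<psi> d x y" if "x \<in> ?M" "y \<in> ?M" for x y
    using ge[OF that, of undefined] nonneg[OF in_X in_X, OF that, of undefined] by linarith
  have M_zero: "dpsi \<psi> d x y = 0 \<longleftrightarrow> x = y" if "x \<in> ?M" "y \<in> ?M" for x y
  proof
    assume "dpsi \<psi> d x y = 0"
    then have "d i (x i) (y i) = 0" for i
      using ge[OF that, of i] nonneg[OF in_X in_X, OF that, of i] by simp
    then show "x = y"
      using zero[OF in_X in_X, OF that] by (simp add: fun_eq_iff)
  qed (simp add: dpsi_def)
  have M_sym: "dpsi \<psi> d x y = dpsi \<psi> d y x" if "x \<in> ?M" "y \<in> ?M" for x y
    using dpsi[of x y] dpsi[of y x] sym[OF in_X in_X, OF that] that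
    by (simp add: dist_vec_def)
  have M_triangle: "dpsi \<psi> d x z \<le> dpsi \<psi> d x y + dpsi \<psi> d y z"
    if "x \<in> ?M" "y \<in> ?M" "z \<in> ?M" for x y z
  proof -
    have conv: "convex_on Omega \<psi>"
      using psi by (simp add: Psi_def)
    have "homogeneous_extension \<psi> (dist_vec x z)
            \<le> homogeneous_extension \<psi> (dist_vec x y + dist_vec y z)"
    proof (rule homogeneous_extension_mono[OF psi vec_nonneg[OF that(1,3)]])
      show "dist_vec x z $ i \<le> (dist_vec x y + dist_vec y z) $ i" for i
        using triangle[OF in_X in_X in_X, OF that, of i] by (simp add: dist_vec_def)
    qed
    also have "\<dots> \<le> homogeneous_extension \<psi> (dist_vec x y) + homogeneous_extension \<psi> (dist_vec y z)"
      by (rule homogeneous_extension_subadditive[OF conv vec_nonneg[OF that(1,2)]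
            vec_nonneg[OF that(2,3)]])
    finally show ?thesis
      using that by (simp add: dpsi)
  qed
  show ?thesis
    unfolding metric_on_iff by (intro conjI ballI M_nonneg M_zero M_sym M_triangle)
qed

theorem theorem3p3:
  fixes X :: "'n::finite \<Rightarrow> 'a set"
    and d :: "'n \<Rightarrow> 'a \<Rightarrow> 'a \<Rightarrow> real"
    and \<psi> :: "real ^ 'n \<Rightarrow> real"
  assumes "CARD('n) \<ge> 2"
    and "\<And>i. X i \<noteq> {}"
    and "\<psi> \<in> Psi"
    and diag: "\<And>i a. a \<in> X i \<Longrightarrow> d i a a = 0"
  shows "(\<forall>i. metric_on (X i) (d i)) \<longleftrightarrow> metric_on (\<Pi>\<^sub>E i\<in>UNIV. X i) (dpsi \<psi> d)"
proof
  assume "\<forall>i. metric_on (X i) (d i)"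
  then show "metric_on (\<Pi>\<^sub>E i\<in>UNIV. X i) (dpsi \<psi> d)"
    using metric_on_dpsi \<open>\<psi> \<in> Psi\<close> by blast
next
  assume M: "metric_on (\<Pi>\<^sub>E i\<in>UNIV. X i) (dpsi \<psi> d)"
  define z where "z i = (SOME a. a \<in> X i)" for i
  have z: "z i \<in> X i" for i
    using assms(2) by (simp add: z_def some_in_eq)
  show "\<forall>i. metric_on (X i) (d i)"
  proof
    fix i
    have vertex: "\<psi> (axis i 1) = 1"
      using \<open>\<psi> \<in> Psi\<close> by (simp add: Psi_def)
    show "metric_on (X i) (d i)"
    proof (rule metric_on_isometric_pullback[OF M])
      show "(\<lambda>a. z(i := a)) ` X i \<subseteq> (\<Pi>\<^sub>E i\<in>UNIV. X i)"
        using z by auto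
      show "inj_on (\<lambda>a. z(i := a)) (X i)"
        by (meson fun_upd_eqD inj_onI)
      show "dpsi \<psi> d (z(i := a)) (z(i := b)) = d i a b" if "a \<in> X i" "b \<in> X i" for a b
        using dpsi_fun_upd[of \<psi> i d z a b] vertex diag z that by blast
    qed
  qed
qed

end
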